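(* Let $1\le m\le n$ be integers and $p\in[0,1]$. Let $\alpha=(a_1,\ldots,a_m)\in[n]^m$ be a preference list chosen uniformly at random, and let the $m$ cars park on $n$ spots under the probabilistic parking protocol with parameter $p$. Then for every $j\in[n]$, $$\mathbb{P}(a_m=j\mid \alpha\in \mathrm{PF}_{m,n})=\frac{n-m+2}{(n-m+1)(n+1)}-\frac{1}{(n+1)^{m-1}}\left[p\sum_{s=n-j+1}^{m-1}\binom{m-1}{s}(n-s)^{m-s-2}(s+1)^{s-1}+(1-p)\sum_{s=j}^{m-1}\binom{m-1}{s}(n-s)^{m-s-2}(s+1)^{s-1}\right],$$ where a sum whose lower index exceeds its upper index is zero.
   Context: $[n]=\{1,\ldots,n\}$. Probabilistic parking protocol with parameter $p\in[0,1]$: there are $m$ cars and a one-way street with $n\ge m$ spots numbered $1,\ldots,n$. Cars $1,\ldots,m$ arrive in order; car $i$ has preference $a_i\in[n]$ and first goes to spot $a_i$. If spot $a_i$ is unoccupied, the car parks there. If it is occupied, the driver tosses (once) a biased coin, independent of everything else: with probability $p$ the car moves forward and parks in the first unoccupied spot with number greater than $a_i$, if one exists; with probability $1-p$ the car moves backward and parks in the first unoccupied spot encountered (the largest unoccupied number less than $a_i$), if one exists. If there is no unoccupied spot in the chosen direction, the car fails to park. "$\alpha\in\mathrm{PF}_{m,n}$" denotes the event that all $m$ cars with preference list $\alpha$ succeed in parking; probabilities are over both the uniform choice of $\alpha\in[n]^m$ and the coin tosses. *)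

theory Defs
  imports "HOL-Probability.Probability"
begin

text \<open>
  Spots are the numbers \<open>1, \<dots>, n\<close>; \<open>Occ\<close> is the set of currently occupied spots. The outcome
  of a car is \<open>Some k\<close> if it parks in spot \<open>k\<close> and \<open>None\<close> if it fails to park.
\<close>

definition forward_spot :: "nat \<Rightarrow> nat set \<Rightarrow> nat \<Rightarrow> nat option" where
  "forward_spot n Occ a =
     (let S = {k \<in> {1..n}. a < k \<and> k \<notin> Occ} in if S = {} then None else Some (Min S))"

definition backward_spot :: "nat \<Rightarrow> nat set \<Rightarrow> nat \<Rightarrow> nat option" where
  "backward_spot n Occ a =
     (let S = {k \<in> {1..n}. k < a \<and> k \<notin> Occ} in if S = {} then None else Some (Max S))"

definition park_car :: "real \<Rightarrow> nat \<Rightarrow> nat set \<Rightarrow> nat \<Rightarrow> nat option pmf" where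
  "park_car p n Occ a =
     (if a \<notin> Occ then return_pmf (Some a)
      else map_pmf (\<lambda>forward. if forward then forward_spot n Occ a else backward_spot n Occ a)
             (bernoulli_pmf p))"

text \<open>
  The list of outcomes of successive cars. A car that fails to park occupies no spot, and
  the cars after it still try to park.
\<close>

primrec park_cars :: "real \<Rightarrow> nat \<Rightarrow> nat set \<Rightarrow> nat list \<Rightarrow> nat option list pmf" where
  "park_cars p n Occ [] = return_pmf []"
| "park_cars p n Occ (a # as) =
     bind_pmf (park_car p n Occ a)
       (\<lambda>r. map_pmf (\<lambda>rs. r # rs) (park_cars p n (Occ \<union> set_option r) as))"

definition preference_lists :: "nat \<Rightarrow> nat \<Rightarrow> nat list set" where
  "preference_lists m n = {\<alpha>. length \<alpha> = m \<and> set \<alpha> \<subseteq> {1..n}}"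

text \<open>The joint law of the preference list and the outcomes of the \<open>m\<close> cars.\<close>

definition parking_experiment :: "real \<Rightarrow> nat \<Rightarrow> nat \<Rightarrow> (nat list \<times> nat option list) pmf" where
  "parking_experiment p m n =
     bind_pmf (pmf_of_set (preference_lists m n))
       (\<lambda>\<alpha>. map_pmf (\<lambda>rs. (\<alpha>, rs)) (park_cars p n {} \<alpha>))"

definition all_parked :: "nat option list \<Rightarrow> bool" where
  "all_parked rs \<longleftrightarrow> None \<notin> set rs"

end

theory Submission
  imports Defs
begin

text \<open>
  Write \<open>w A\<close> for the sum, over all preference lists of \<open>card A\<close> cars, of the probability that the cars
  all park and fill exactly the set \<open>A\<close>; this is \<open>filling_weight\<close>. If the last of these cars takes
  spot \<open>x\<close>, then it preferred \<open>x\<close> itself, or a spot of the run of occupied spots that ends just left of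
  \<open>x\<close> (and tossed forward), or a spot of the run that starts just right of \<open>x\<close> (and tossed backward).
  Hence \<open>w\<close> satisfies a recursion over the last car in which only the two runs next to \<open>x\<close> matter.
  Everything about the process that enters the theorem is a sum of values of \<open>w\<close>
  (\<open>sum_mean_if_parked\<close>), so the rest is the evaluation of such sums.

  Because the recursion is local, two sets of spots with a free spot between them fill independently, up
  to a shuffle of the cars: \<open>w (A \<union> B)\<close> is \<open>w A * w B\<close> times a binomial coefficient
  (\<open>filling_weight_separated\<close>). For an interval of \<open>s\<close> spots, cutting it at the spot of the last car
  gives a convolution whose factors \<open>1 + p * i + (1 - p) * (s - 1 - i)\<close> may be averaged with their
  mirror images; \<open>p\<close> disappears, and Abel's binomial identity yields the classical value
  \<open>(s + 1) ^ (s - 1)\<close> (\<open>filling_weight_interval\<close>). Decomposing an arbitrary filled set at the first free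
  spot and applying Abel's identity once more, the sum of \<open>w A\<close> over the \<open>k\<close>-subsets of \<open>N\<close>
  consecutive spots is \<open>(N - k + 1) * (N + 1) ^ (k - 1)\<close> (\<open>filling_sum_interval\<close>). For \<open>k = m\<close> and
  \<open>N = n\<close> this is \<open>n ^ m\<close> times the probability that all cars park.

  Now let the first \<open>m - 1\<close> cars fill \<open>A\<close>. A last car with preference \<open>j\<close> fails exactly if it moves
  forward and \<open>{j..n} \<subseteq> A\<close>, or moves backward and \<open>{1..j} \<subseteq> A\<close>. The first term of the formula
  comes from \<open>m - 1\<close> cars parking; the two sums subtract the failures, classified by the
  length \<open>s\<close> of the full block of \<open>A\<close> at the right or the left end of the street. Such a block has
  weight \<open>(s + 1) ^ (s - 1)\<close>, is shuffled with the other cars in \<open>(m - 1) choose s\<close> ways, and leaves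
  \<open>n - s - 1\<close> spots on the far side of its neighbouring gap.
\<close>


section \<open>Abel's binomial identities\<close>

text \<open>
  An \<open>m\<close>-th finite difference annihilates polynomials of degree below \<open>m\<close>. One factor \<open>x + s\<close> is
  split off at a time: the part \<open>x\<close> lowers the degree, and the part \<open>s\<close> is absorbed by the
  binomial coefficient, which lowers \<open>m\<close> and shifts \<open>x\<close>.
\<close>

lemma alternating_binomial_sum_of_power:
  fixes x :: "'a::comm_ring_1"
  assumes "k < m"
  shows "(\<Sum>s\<le>m. (-1) ^ s * of_nat (m choose s) * (x + of_nat s) ^ k) = 0"
  using assms
proof (induction k arbitrary: m x)
  case 0
  then show ?case
    using choose_alternating_sum[of m, where 'a='a] by simp
next
  case (Suc k)
  then obtain m' where m: "m = Suc m'" and "k < m'"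
    by (cases m) auto
  let ?f = "\<lambda>s. (-1) ^ s * of_nat (m choose s) * (x + of_nat s) ^ k"
  have "(\<Sum>s\<le>m. (-1) ^ s * of_nat (m choose s) * (x + of_nat s) ^ Suc k)
      = x * (\<Sum>s\<le>m. ?f s) + (\<Sum>s\<le>m. of_nat s * ?f s)"
    by (simp add: sum_distrib_left algebra_simps flip: sum.distrib)
  also have "(\<Sum>s\<le>m. of_nat s * ?f s) = (\<Sum>s\<le>m'. of_nat (Suc s) * ?f (Suc s))"
    unfolding m sum.atMost_Suc_shift by simp
  also have "\<dots> = (\<Sum>s\<le>m'. - of_nat m * ((-1) ^ s * of_nat (m' choose s) * (x + 1 + of_nat s) ^ k))"
  proof (rule sum.cong[OF refl])
    fix s
    have "of_nat (Suc s) * of_nat (m choose Suc s) = (of_nat (m * (m' choose s)) :: 'a)"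
      unfolding m Suc_times_binomial[symmetric] by (simp only: of_nat_mult)
    then have absorb: "of_nat (Suc s) * of_nat (m choose Suc s) = (of_nat m * of_nat (m' choose s) :: 'a)"
      by (simp only: of_nat_mult)
    have "of_nat (Suc s) * ?f (Suc s)
        = - (of_nat (Suc s) * of_nat (m choose Suc s)) * ((-1) ^ s * (x + of_nat (Suc s)) ^ k)"
      by (simp only: power_Suc mult_minus_left mult_minus_right mult_1_left mult_ac)
    moreover have "x + of_nat (Suc s) = x + 1 + of_nat s"
      by (simp only: of_nat_Suc add_ac)
    ultimately show "of_nat (Suc s) * ?f (Suc s) = - of_nat m * ((-1) ^ s * of_nat (m' choose s) * (x + 1 + of_nat s) ^ k)"
      unfolding absorb by (simp only: mult_minus_left mult_minus_right mult_ac)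
  qed
  also have "\<dots> = - of_nat m * (\<Sum>s\<le>m'. (-1) ^ s * of_nat (m' choose s) * (x + 1 + of_nat s) ^ k)"
    by (simp only: sum_distrib_left)
  also have "(\<Sum>s\<le>m'. (-1) ^ s * of_nat (m' choose s) * (x + 1 + of_nat s) ^ k) = 0"
    using Suc.IH[of m' "x + 1"] \<open>k < m'\<close> by simp
  also have "(\<Sum>s\<le>m. ?f s) = 0"
    using Suc.IH[of m x] \<open>k < m'\<close> m by simp
  finally show ?case by simp
qed

text \<open>
  Abel's identity, by induction on \<open>m\<close>. As functions of \<open>y\<close>, both sides have as derivative \<open>m\<close>
  times the case \<open>m - 1\<close> at \<open>y + 1\<close>, so they differ by a constant; at \<open>y = - x - m\<close> the right-hand side
  vanishes and the left-hand side is a finite difference of order \<open>m\<close> of a power of degree \<open>m - 1\<close>.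
  The power \<open>(x + s) ^ (s - 1)\<close> is written as a quotient, which is right also for \<open>s = 0\<close>.
\<close>

lemma abel_binomial:
  fixes x y :: real
  assumes "x > 0"
  shows "(\<Sum>s\<le>m. real (m choose s) * ((x + s) ^ s / (x + s)) * (y + real (m - s)) ^ (m - s))
       = (x + y + m) ^ m / x"
proof (induction m arbitrary: y)
  case 0
  then show ?case by simp
next
  case (Suc m)
  define c where "c s = real (Suc m choose s) * ((x + s) ^ s / (x + s))" for s
  \<comment> \<open>the two sides agree as functions of \<open>y\<close> if \<open>F\<close> is constant with a zero\<close>
  define F where "F y = (\<Sum>s\<le>Suc m. c s * (y + real (Suc m - s)) ^ (Suc m - s)) - (x + y + Suc m) ^ Suc m / x" for y
  have "(F has_real_derivative 0) (at y)" for y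
  proof -
    have D: "(\<Sum>s\<le>Suc m. c s * (real (Suc m - s) * (y + real (Suc m - s)) ^ (Suc m - s - 1)))
       = Suc m * ((x + (y + 1) + m) ^ m / x)"
    proof -
      have "(\<Sum>s\<le>Suc m. c s * (real (Suc m - s) * (y + real (Suc m - s)) ^ (Suc m - s - 1)))
        = (\<Sum>s\<le>m. c s * (real (Suc m - s) * (y + real (Suc m - s)) ^ (Suc m - s - 1)))"
        by simp
      also have "\<dots> = (\<Sum>s\<le>m. real (Suc m) * (real (m choose s) * ((x + s) ^ s / (x + s)) * (y + 1 + real (m - s)) ^ (m - s)))"
      proof (rule sum.cong[OF refl])
        fix s assume "s \<in> {..m}"
        then have s: "s \<le> m" by simp
        have "(Suc m - s) * (Suc m choose s) = Suc m * (m choose s)"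
          using binomial_absorb_comp[of "Suc m" s] by simp
        then have b: "real (Suc m - s) * real (Suc m choose s) = real (Suc m) * real (m choose s)"
          by (metis of_nat_mult)
        have e: "y + real (Suc m - s) = y + 1 + real (m - s)" "Suc m - s - 1 = m - s"
          using s by auto
        have "c s * (real (Suc m - s) * (y + real (Suc m - s)) ^ (Suc m - s - 1))
          = (real (Suc m - s) * real (Suc m choose s)) * ((x + s) ^ s / (x + s)) * (y + 1 + real (m - s)) ^ (m - s)"
          unfolding c_def e by (simp only: mult_ac)
        then show "c s * (real (Suc m - s) * (y + real (Suc m - s)) ^ (Suc m - s - 1))
          = real (Suc m) * (real (m choose s) * ((x + s) ^ s / (x + s)) * (y + 1 + real (m - s)) ^ (m - s))"
          unfolding b by (simp only: mult_ac)
      qed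
      finally show ?thesis
        by (simp only: Suc.IH sum_distrib_left[symmetric])
    qed
    have "(F has_real_derivative
        (\<Sum>s\<le>Suc m. c s * (real (Suc m - s) * (y + real (Suc m - s)) ^ (Suc m - s - 1)))
        - Suc m * (x + y + Suc m) ^ m / x) (at y)"
      unfolding F_def
    proof (rule DERIV_diff[OF DERIV_sum])
      show "((\<lambda>y. c s * (y + real (Suc m - s)) ^ (Suc m - s)) has_real_derivative
          c s * (real (Suc m - s) * (y + real (Suc m - s)) ^ (Suc m - s - 1))) (at y)" for s
        by (auto intro!: derivative_eq_intros)
      have "((\<lambda>y. (x + y + Suc m) ^ Suc m) has_real_derivative Suc m * (x + y + Suc m) ^ m) (at y)"
        by (auto intro!: derivative_eq_intros simp del: power_Suc)
      then show "((\<lambda>y. (x + y + Suc m) ^ Suc m / x) has_real_derivative Suc m * (x + y + Suc m) ^ m / x) (at y)"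
        by (rule DERIV_cdivide)
    qed
    then show ?thesis
      unfolding D by (simp add: add_ac)
  qed
  then have "F y = F (- x - Suc m)"
    using DERIV_isconst_all by blast
  also have "F (- x - Suc m) = 0"
  proof -
    have "c s * (- x - Suc m + real (Suc m - s)) ^ (Suc m - s)
        = (-1) ^ Suc m * ((-1) ^ s * real (Suc m choose s) * (x + s) ^ m)" if "s \<le> Suc m" for s
    proof -
      have "- x - Suc m + real (Suc m - s) = (-1) * (x + s)"
        using that by (simp add: of_nat_diff)
      then have "(- x - Suc m + real (Suc m - s)) ^ (Suc m - s) = (-1) ^ (Suc m - s) * (x + s) ^ (Suc m - s)"
        by (simp only: power_mult_distrib)
      moreover have "(-1) ^ (Suc m - s) = (-1) ^ Suc m * ((-1::real) ^ s)"
      proof -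
        have "(-1) ^ (s + t) * (-1) ^ s = ((-1::real) ^ t)" for t
          by (cases "even s"; simp add: power_add)
        from this[of "Suc m - s"] show ?thesis
          using that by (simp del: power_Suc)
      qed
      moreover have "(x + s) ^ s / (x + s) * (x + s) ^ (Suc m - s) = (x + s) ^ m"
      proof -
        have "(x + s) ^ s / (x + s) * (x + s) ^ (Suc m - s) = (x + s) ^ (s + (Suc m - s)) / (x + s)"
          by (simp add: power_add)
        also have "s + (Suc m - s) = Suc m" using that by simp
        finally show ?thesis using assms by simp
      qed
      ultimately show ?thesis
        unfolding c_def by (simp only: mult_ac)
    qed
    then have "(\<Sum>s\<le>Suc m. c s * (- x - Suc m + real (Suc m - s)) ^ (Suc m - s))
      = (-1) ^ Suc m * (\<Sum>s\<le>Suc m. (-1) ^ s * real (Suc m choose s) * (x + s) ^ m)"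
      by (simp add: sum_distrib_left del: sum.atMost_Suc power_Suc binomial_Suc_Suc)
    also have "\<dots> = 0"
      using alternating_binomial_sum_of_power[of m "Suc m" x] by simp
    finally show ?thesis
      unfolding F_def by simp
  qed
  finally show ?case
    unfolding F_def c_def by simp
qed

text \<open>
  Multiplying the summand by \<open>x + y + m = (x + s) + (y + (m - s))\<close> removes one denominator or the
  other, which leaves two instances of the previous identity with \<open>x\<close> and \<open>y\<close> exchanged.
\<close>

lemma abel_binomial_symmetric:
  fixes x y :: real
  assumes "x > 0" and "y > 0"
  shows "(\<Sum>s\<le>m. real (m choose s) * ((x + s) ^ s / (x + s)) * ((y + real (m - s)) ^ (m - s) / (y + real (m - s))))
       = (1 / x + 1 / y) * (x + y + m) ^ m / (x + y + m)"
proof -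
  let ?u = "\<lambda>s. (x + s) ^ s" and ?v = "\<lambda>s. (y + real (m - s)) ^ (m - s)"
  have "(x + y + m) * (\<Sum>s\<le>m. real (m choose s) * (?u s / (x + s)) * (?v s / (y + real (m - s))))
      = (\<Sum>s\<le>m. real (m choose s) * (?u s / (x + s)) * ?v s)
        + (\<Sum>s\<le>m. real (m choose s) * ?u s * (?v s / (y + real (m - s))))"
    unfolding sum_distrib_left sum.distrib[symmetric]
  proof (rule sum.cong[OF refl])
    fix s assume "s \<in> {..m}"
    then have e: "x + y + m = (x + s) + (y + real (m - s))" by (simp add: of_nat_diff)
    have pos: "x + s > 0" "y + real (m - s) > 0" using assms by (simp_all add: add_pos_nonneg)
    have "(P + R) * (c * (u / P) * (v / R)) = c * (u / P) * v + c * u * (v / R)"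
      if "P > 0" "R > 0" for P R c u v :: real
      using that by (simp add: field_simps)
    from this[OF pos, of "real (m choose s)" "?u s" "?v s", folded e]
    show "(x + y + m) * (real (m choose s) * (?u s / (x + s)) * (?v s / (y + real (m - s))))
       = real (m choose s) * (?u s / (x + s)) * ?v s + real (m choose s) * ?u s * (?v s / (y + real (m - s)))" .
  qed
  also have "(\<Sum>s\<le>m. real (m choose s) * ?u s * (?v s / (y + real (m - s))))
      = (\<Sum>s\<le>m. real (m choose s) * ((y + s) ^ s / (y + s)) * (x + real (m - s)) ^ (m - s))"
  proof (rule sum.reindex_bij_witness[of _ "\<lambda>s. m - s" "\<lambda>s. m - s"])
    fix s assume "s \<in> {..m}"
    then have "m choose (m - s) = m choose s" "m - (m - s) = s"
      using binomial_symmetric[of s m] by simp_all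
    then show "real (m choose (m - s)) * ((y + real (m - s)) ^ (m - s) / (y + real (m - s)))
        * (x + real (m - (m - s))) ^ (m - (m - s)) = real (m choose s) * ?u s * (?v s / (y + real (m - s)))"
      by (simp only: mult_ac)
  qed auto
  also have "(\<Sum>s\<le>m. real (m choose s) * (?u s / (x + s)) * ?v s) = (x + y + m) ^ m / x"
    using assms(1) by (rule abel_binomial)
  also have "(\<Sum>s\<le>m. real (m choose s) * ((y + s) ^ s / (y + s)) * (x + real (m - s)) ^ (m - s))
      = (x + y + m) ^ m / y"
    using abel_binomial[OF assms(2), of m x] by (simp only: add.commute[of y x])
  finally have "(x + y + m) * (\<Sum>s\<le>m. real (m choose s) * (?u s / (x + s)) * (?v s / (y + real (m - s))))
      = (1 / x + 1 / y) * (x + y + m) ^ m"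
    by (simp add: distrib_right)
  moreover have "x + y + m > 0"
    using assms by (simp add: add_pos_nonneg)
  ultimately show ?thesis
    by (simp add: nonzero_eq_divide_eq mult.commute)
qed

section \<open>The weight of a filled set of spots\<close>

definition left_run :: "nat set \<Rightarrow> nat \<Rightarrow> nat" where
  "left_run B k = card {a. a < k \<and> {a..<k} \<subseteq> B}"

definition right_run :: "nat set \<Rightarrow> nat \<Rightarrow> nat" where
  "right_run B k = card {a. k < a \<and> {k<..a} \<subseteq> B}"

text \<open>
  The expected number of preferences with which the next car parks in the free spot \<open>k\<close>, when \<open>B\<close> is
  the set of occupied spots: \<open>k\<close> itself, and each spot of the two adjacent runs weighted with the
  probability of the matching direction.
\<close>

definition landing_weight :: "real \<Rightarrow> nat set \<Rightarrow> nat \<Rightarrow> real" where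
  "landing_weight p B k = 1 + p * left_run B k + (1 - p) * right_run B k"

text \<open>
  The recursion removes the spot of the last car. The number of cars is carried along as a separate
  argument to make the recursion primitive; in every use it is the cardinality of the set.
\<close>

primrec filling_weight_steps :: "real \<Rightarrow> nat \<Rightarrow> nat set \<Rightarrow> real" where
  "filling_weight_steps p 0 A = 1"
| "filling_weight_steps p (Suc k) A =
     (\<Sum>x\<in>A. filling_weight_steps p k (A - {x}) * landing_weight p (A - {x}) x)"

definition filling_weight :: "real \<Rightarrow> nat set \<Rightarrow> real" where
  "filling_weight p A = filling_weight_steps p (card A) A"

text \<open>
  Disjointness together with a gap: no element of one set is adjacent to an element of the other, so
  a run of occupied spots cannot cross over.
\<close>

definition separated :: "nat set \<Rightarrow> nat set \<Rightarrow> bool" where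
  "separated A B \<longleftrightarrow> (\<forall>a\<in>A. \<forall>b\<in>B. a \<noteq> b \<and> a \<noteq> Suc b \<and> b \<noteq> Suc a)"

lemma filling_weight_empty [simp]: "filling_weight p {} = 1"
  by (simp add: filling_weight_def)

lemma filling_weight_last_car:
  assumes "finite A" and "A \<noteq> {}"
  shows "filling_weight p A =
    (\<Sum>x\<in>A. filling_weight p (A - {x}) * landing_weight p (A - {x}) x)"
proof -
  obtain k where k: "card A = Suc k"
    using assms by (cases "card A") auto
  then have "card (A - {x}) = k" if "x \<in> A" for x
    using that by simp
  with k show ?thesis
    by (simp add: filling_weight_def)
qed

lemma separated_sym: "separated A B \<Longrightarrow> separated B A"
  unfolding separated_def by blast

lemma separated_mono: "separated A B \<Longrightarrow> A' \<subseteq> A \<Longrightarrow> B' \<subseteq> B \<Longrightarrow> separated A' B'"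
  unfolding separated_def by blast

lemma separated_disjoint: "separated A B \<Longrightarrow> A \<inter> B = {}"
  unfolding separated_def by blast

text \<open>
  A run that starts next to \<open>x\<close> stays in \<open>A\<close>: leaving \<open>A\<close> would mean stepping from a point of \<open>A\<close> to an
  adjacent point of \<open>B\<close>.
\<close>

lemma landing_weight_separated:
  assumes "separated A B" and "x \<in> A"
  shows "landing_weight p (A - {x} \<union> B) x = landing_weight p (A - {x}) x"
proof -
  have "{a..<x} \<subseteq> A" if run: "a < x" "{a..<x} \<subseteq> A - {x} \<union> B" for a
  proof
    fix c assume c: "c \<in> {a..<x}"
    then have "c \<le> x" by simp
    then show "c \<in> A"
      using c
    proof (induction rule: inc_induct)
      case (step c)
      then have "Suc c \<in> A"
        using assms(2) by (cases "Suc c = x") auto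
      moreover have "c \<in> {a..<x}"
        using step by auto
      then have "c \<in> A \<union> B"
        using run by blast
      ultimately show ?case
        using assms(1) unfolding separated_def by blast
    qed (use assms in simp)
  qed
  then have L: "left_run (A - {x} \<union> B) x = left_run (A - {x}) x"
    unfolding left_run_def by (intro arg_cong[where f = card]) fastforce
  have "{x<..a} \<subseteq> A" if run: "x < a" "{x<..a} \<subseteq> A - {x} \<union> B" for a
  proof
    fix c assume c: "c \<in> {x<..a}"
    then have "x \<le> c" by simp
    then show "c \<in> A"
      using c
    proof (induction rule: dec_induct)
      case (step c)
      then have "c \<in> A"
        using assms(2) by (cases "c = x") auto
      moreover have "Suc c \<in> {x<..a}"
        using step by auto
      then have "Suc c \<in> A \<union> B"
        using run by blast
      ultimately show ?case
        using assms(1) unfolding separated_def by blast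
    qed (use assms in simp)
  qed
  then have R: "right_run (A - {x} \<union> B) x = right_run (A - {x}) x"
    unfolding right_run_def by (intro arg_cong[where f = card]) fastforce
  show ?thesis
    unfolding landing_weight_def L R ..
qed

text \<open>
  Separated sets fill independently, and the binomial coefficient counts the interleavings of their
  cars. The last car belongs to one of the two sets, and the two cases add up by Pascal's rule.
\<close>

lemma filling_weight_separated:
  assumes "finite A" and "finite B" and "separated A B"
  shows "filling_weight p (A \<union> B)
       = real ((card A + card B) choose card A) * filling_weight p A * filling_weight p B"
  using assms
proof (induction "card A + card B" arbitrary: A B rule: less_induct)
  case less
  note fin = \<open>finite A\<close> \<open>finite B\<close>
  show ?case
  proof (cases "A = {} \<or> B = {}")
    case True
    then show ?thesis by auto
  next
    case False
    define a where "a = card A - 1"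
    define b where "b = card B - 1"
    have a: "card A = Suc a" and b: "card B = Suc b"
      using False fin unfolding a_def b_def by (auto simp: card_gt_0_iff)
    have disj: "A \<inter> B = {}"
      using less.prems(3) by (rule separated_disjoint)
    let ?w = "filling_weight p" and ?g = "landing_weight p"
    have lastA: "?w (A \<union> B - {x}) * ?g (A \<union> B - {x}) x
        = real ((a + Suc b) choose a) * ?w B * (?w (A - {x}) * ?g (A - {x}) x)" if x: "x \<in> A" for x
    proof -
      have e: "A \<union> B - {x} = A - {x} \<union> B"
        using x disj by blast
      have "?w (A - {x} \<union> B) = real ((a + Suc b) choose a) * ?w (A - {x}) * ?w B"
        using less.hyps[of "A - {x}" B] x a b fin separated_mono[OF less.prems(3), of "A - {x}" B]
        by auto
      then show ?thesis
        unfolding e landing_weight_separated[OF less.prems(3) x] by (simp only: mult_ac)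
    qed
    have lastB: "?w (A \<union> B - {x}) * ?g (A \<union> B - {x}) x
        = real ((Suc a + b) choose Suc a) * ?w A * (?w (B - {x}) * ?g (B - {x}) x)" if x: "x \<in> B" for x
    proof -
      have e: "A \<union> B - {x} = B - {x} \<union> A"
        using x disj by blast
      have "?w (A \<union> (B - {x})) = real ((Suc a + b) choose Suc a) * ?w A * ?w (B - {x})"
        using less.hyps[of A "B - {x}"] x a b fin separated_mono[OF less.prems(3), of A "B - {x}"]
        by auto
      then show ?thesis
        unfolding e landing_weight_separated[OF separated_sym[OF less.prems(3)] x]
        by (simp only: mult_ac Un_commute)
    qed
    have "?w (A \<union> B) = (\<Sum>x\<in>A. ?w (A \<union> B - {x}) * ?g (A \<union> B - {x}) x)
        + (\<Sum>x\<in>B. ?w (A \<union> B - {x}) * ?g (A \<union> B - {x}) x)"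
      using filling_weight_last_car[of "A \<union> B" p] False fin disj by (simp add: sum.union_disjoint)
    also have "\<dots> = real ((a + Suc b) choose a) * ?w B * ?w A + real ((Suc a + b) choose Suc a) * ?w A * ?w B"
      using lastA lastB False fin
      by (simp add: sum_distrib_left[symmetric] filling_weight_last_car[of A] filling_weight_last_car[of B]
          del: binomial_Suc_Suc)
    also have "\<dots> = (real ((a + Suc b) choose a) + real ((a + Suc b) choose Suc a)) * ?w A * ?w B"
      by (simp add: algebra_simps del: binomial_Suc_Suc)
    also have "real ((a + Suc b) choose a) + real ((a + Suc b) choose Suc a)
        = real ((card A + card B) choose card A)"
      unfolding a b by simp
    finally show ?thesis .
  qed
qed

lemma left_run_interval:
  "left_run ({l..<k} \<union> {Suc k..<r}) k = k - l"
proof -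
  have "{a. a < k \<and> {a..<k} \<subseteq> {l..<k} \<union> {Suc k..<r}} = {l..<k}"
    by (auto simp: subset_iff)
  then show ?thesis
    unfolding left_run_def by simp
qed

lemma right_run_interval:
  "right_run ({l..<k} \<union> {Suc k..<r}) k = r - Suc k"
proof -
  have "{a. k < a \<and> {k<..a} \<subseteq> {l..<k} \<union> {Suc k..<r}} = {Suc k..<r}"
    by (auto simp: subset_iff)
  then show ?thesis
    unfolding right_run_def by simp
qed

text \<open>
  The spot of the last car splits the interval into separated intervals of lengths \<open>i\<close> and \<open>N - i\<close>. The
  convolution is symmetric under \<open>i \<mapsto> N - i\<close>, so \<open>i + 1\<close> and \<open>N - i + 1\<close> have the same sum against it
  and the dependence on \<open>p\<close> cancels. What remains is Abel's identity with \<open>x = y = 1\<close>. The value is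
  \<open>(s + 1) ^ (s - 1)\<close>, written as a quotient to cover \<open>s = 0\<close>.
\<close>

lemma filling_weight_interval:
  "filling_weight p {l..<l + s} = real (s + 1) ^ s / real (s + 1)"
proof (induction s arbitrary: l rule: less_induct)
  case (less s)
  show ?case
  proof (cases s)
    case 0
    then show ?thesis by simp
  next
    case (Suc N)
    let ?f = "\<lambda>i. real (i + 1) ^ i / real (i + 1)"
    let ?c = "\<lambda>i. real (N choose i) * ?f i * ?f (N - i)"
    have summand: "filling_weight p ({l..<l + s} - {l + i}) * landing_weight p ({l..<l + s} - {l + i}) (l + i)
        = p * (?c i * real (i + 1)) + (1 - p) * (?c i * real (N - i + 1))" if i: "i \<le> N" for i
    proof -
      let ?A = "{l..<l + i}" and ?B = "{Suc (l + i)..<Suc (l + i) + (N - i)}"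
      have e: "{l..<l + s} - {l + i} = ?A \<union> ?B"
        using i Suc by auto
      have "separated ?A ?B"
        unfolding separated_def by auto
      then have "filling_weight p (?A \<union> ?B)
          = real (N choose i) * filling_weight p ?A * filling_weight p ?B"
        using filling_weight_separated[of ?A ?B p] i by simp
      also have "\<dots> = ?c i"
        using less.IH[of i l] less.IH[of "N - i" "Suc (l + i)"] i Suc by simp
      finally have w: "filling_weight p (?A \<union> ?B) = ?c i" .
      have g: "landing_weight p (?A \<union> ?B) (l + i) = p * real (i + 1) + (1 - p) * real (N - i + 1)"
        unfolding landing_weight_def left_run_interval right_run_interval
        by (simp add: algebra_simps)
      show ?thesis
        unfolding e w g by (simp only: distrib_left mult.left_commute[of "?c i"])
    qed
    have "filling_weight p {l..<l + s}
        = (\<Sum>x\<in>{l..<l + s}. filling_weight p ({l..<l + s} - {x}) * landing_weight p ({l..<l + s} - {x}) x)"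
      by (rule filling_weight_last_car) (simp_all add: Suc)
    also have "\<dots> = (\<Sum>i\<le>N. filling_weight p ({l..<l + s} - {l + i}) * landing_weight p ({l..<l + s} - {l + i}) (l + i))"
      by (rule sum.reindex_bij_witness[of _ "\<lambda>i. l + i" "\<lambda>x. x - l"]) (auto simp: Suc)
    also have "\<dots> = (\<Sum>i\<le>N. p * (?c i * real (i + 1)) + (1 - p) * (?c i * real (N - i + 1)))"
      using summand by (intro sum.cong) simp_all
    also have "\<dots> = p * (\<Sum>i\<le>N. ?c i * real (i + 1)) + (1 - p) * (\<Sum>i\<le>N. ?c i * real (N - i + 1))"
      by (simp only: sum.distrib sum_distrib_left)
    \<comment> \<open>reflection of the interval\<close>
    also have "(\<Sum>i\<le>N. ?c i * real (i + 1)) = (\<Sum>i\<le>N. ?c i * real (N - i + 1))"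
    proof (rule sum.reindex_bij_witness[of _ "\<lambda>i. N - i" "\<lambda>i. N - i"])
      fix i assume "i \<in> {..N}"
      then have "N choose (N - i) = N choose i" "N - (N - i) = i"
        using binomial_symmetric[of i N] by simp_all
      then show "?c (N - i) * real (N - (N - i) + 1) = ?c i * real (i + 1)"
        by (simp only: mult_ac)
    qed auto
    also have "p * (\<Sum>i\<le>N. ?c i * real (N - i + 1)) + (1 - p) * (\<Sum>i\<le>N. ?c i * real (N - i + 1))
        = (\<Sum>i\<le>N. ?c i * real (N - i + 1))"
      by (simp add: algebra_simps)
    also have "\<dots> = (\<Sum>i\<le>N. real (N choose i) * ((1 + real i) ^ i / (1 + real i)) * (1 + real (N - i)) ^ (N - i))"
      by (intro sum.cong) (simp_all add: add_ac)
    also have "\<dots> = real (s + 1) ^ N"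
      using abel_binomial[of 1 N 1] by (simp add: Suc add_ac)
    also have "\<dots> = real (s + 1) ^ s / real (s + 1)"
      by (simp add: Suc)
    finally show ?thesis .
  qed
qed

section \<open>Sums of weights over the sets in an interval\<close>

definition filling_sum :: "real \<Rightarrow> nat set \<Rightarrow> nat \<Rightarrow> real" where
  "filling_sum p X k = (\<Sum>A | A \<subseteq> X \<and> card A = k. filling_weight p A)"

lemma sum_filling_weight_block:
  assumes "finite I" and "finite R" and "separated I R" and "card I \<le> k"
  shows "(\<Sum>A | A \<subseteq> I \<union> R \<and> I \<subseteq> A \<and> card A = k. filling_weight p A)
       = real (k choose card I) * filling_weight p I * filling_sum p R (k - card I)"
proof -
  have disj: "I \<inter> R = {}"
    using assms(3) by (rule separated_disjoint)
  have "(\<Sum>A | A \<subseteq> I \<union> R \<and> I \<subseteq> A \<and> card A = k. filling_weight p A)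
      = (\<Sum>B | B \<subseteq> R \<and> card B = k - card I. filling_weight p (I \<union> B))"
  proof (rule sum.reindex_bij_witness[of _ "\<lambda>B. I \<union> B" "\<lambda>A. A - I"])
    fix B assume B: "B \<in> {B. B \<subseteq> R \<and> card B = k - card I}"
    then have "I \<inter> B = {}" "finite B"
      using disj assms(2) by (auto intro: finite_subset)
    then show "I \<union> B \<in> {A. A \<subseteq> I \<union> R \<and> I \<subseteq> A \<and> card A = k}"
      using B assms(1,4) by (auto simp: card_Un_disjoint)
    show "I \<union> B - I = B"
      using \<open>I \<inter> B = {}\<close> by auto
  qed (use assms(1) in \<open>auto simp: card_Diff_subset Un_absorb1\<close>)
  also have "\<dots> = (\<Sum>B | B \<subseteq> R \<and> card B = k - card I.
      real (k choose card I) * filling_weight p I * filling_weight p B)"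
  proof (rule sum.cong[OF refl])
    fix B assume B: "B \<in> {B. B \<subseteq> R \<and> card B = k - card I}"
    then have "finite B" "separated I B" "card I + card B = k"
      using assms by (auto intro: finite_subset separated_mono)
    then show "filling_weight p (I \<union> B) = real (k choose card I) * filling_weight p I * filling_weight p B"
      using filling_weight_separated[OF assms(1), of B p] by simp
  qed
  finally show ?thesis
    unfolding filling_sum_def by (simp only: sum_distrib_left)
qed

lemma sum_small_supersets_eq_0:
  assumes "finite X" and "k < card I"
  shows "(\<Sum>A | A \<subseteq> X \<and> I \<subseteq> A \<and> card A = k. f A) = (0 :: real)"
proof -
  have "card A \<noteq> k" if "A \<subseteq> X" "I \<subseteq> A" for A
    using card_mono[OF finite_subset[OF that(1) assms(1)] that(2)] assms(2) by simp
  then have "{A. A \<subseteq> X \<and> I \<subseteq> A \<and> card A = k} = {}"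
    by blast
  then show ?thesis
    by (simp only: sum.empty)
qed

text \<open>
  Common to the two ends of a street \<open>X\<close>: \<open>I s\<close> is the block of the \<open>s\<close> spots nearest to the end, \<open>x s\<close> the
  spot next to this block, and \<open>R s\<close> the rest of the street. A set that contains \<open>I s\<close> either contains
  \<open>I (Suc s)\<close> or has its first gap at \<open>x s\<close>, in which case it splits into separated parts. Iterating
  from \<open>j\<close> stops at \<open>Suc k\<close>, since a set with \<open>k\<close> elements contains no larger block.
\<close>

lemma sum_filling_weight_by_first_gap:
  assumes "finite X" and "j \<le> Suc k"
    and grow: "\<And>s. s \<le> k \<Longrightarrow> I (Suc s) = insert (x s) (I s)"
    and split: "\<And>s. s \<le> k \<Longrightarrow> X - {x s} = I s \<union> R s"
    and sep: "\<And>s. s \<le> k \<Longrightarrow> separated (I s) (R s)"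
    and card: "\<And>s. s \<le> Suc k \<Longrightarrow> card (I s) = s"
  shows "(\<Sum>A | A \<subseteq> X \<and> I j \<subseteq> A \<and> card A = k. filling_weight p A)
       = (\<Sum>s = j..k. real (k choose s) * filling_weight p (I s) * filling_sum p (R s) (k - s))"
  using assms(2)
proof (induction rule: inc_induct)
  case base
  show ?case
    using sum_small_supersets_eq_0[OF assms(1), of k "I (Suc k)" "filling_weight p"] card[of "Suc k"] by simp
next
  case (step s)
  then have s: "s \<le> k" by simp
  have fin: "finite (I s)" "finite (R s)"
    using split[OF s] assms(1) by (metis finite_Diff finite_Un)+
  have *: "{A. A \<subseteq> X \<and> I s \<subseteq> A \<and> card A = k}
      = {A. A \<subseteq> X \<and> I (Suc s) \<subseteq> A \<and> card A = k} \<union> {A. A \<subseteq> I s \<union> R s \<and> I s \<subseteq> A \<and> card A = k}"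
    unfolding grow[OF s] split[OF s, symmetric] by blast
  have "(\<Sum>A | A \<subseteq> X \<and> I s \<subseteq> A \<and> card A = k. filling_weight p A)
      = (\<Sum>A | A \<subseteq> X \<and> I (Suc s) \<subseteq> A \<and> card A = k. filling_weight p A)
        + (\<Sum>A | A \<subseteq> I s \<union> R s \<and> I s \<subseteq> A \<and> card A = k. filling_weight p A)"
    unfolding *
  proof (rule sum.union_disjoint)
    show "finite {A. A \<subseteq> X \<and> I (Suc s) \<subseteq> A \<and> card A = k}"
      using assms(1) by (rule rev_finite_subset[OF finite_Pow_iff[THEN iffD2]]) blast
    show "finite {A. A \<subseteq> I s \<union> R s \<and> I s \<subseteq> A \<and> card A = k}"
      using fin by (rule rev_finite_subset[OF finite_Pow_iff[THEN iffD2, OF finite_UnI]]) blast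
    show "{A. A \<subseteq> X \<and> I (Suc s) \<subseteq> A \<and> card A = k} \<inter> {A. A \<subseteq> I s \<union> R s \<and> I s \<subseteq> A \<and> card A = k} = {}"
      unfolding grow[OF s] split[OF s, symmetric] by auto
  qed
  also have "(\<Sum>A | A \<subseteq> I s \<union> R s \<and> I s \<subseteq> A \<and> card A = k. filling_weight p A)
      = real (k choose s) * filling_weight p (I s) * filling_sum p (R s) (k - s)"
    using sum_filling_weight_block[OF fin sep[OF s], of k p] card[of s] s by simp
  also have "(\<Sum>A | A \<subseteq> X \<and> I (Suc s) \<subseteq> A \<and> card A = k. filling_weight p A)
      = (\<Sum>s = Suc s..k. real (k choose s) * filling_weight p (I s) * filling_sum p (R s) (k - s))"
    by (rule step.IH)
  finally show ?case
    using s by (simp add: sum.atLeast_Suc_atMost)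
qed

lemma sum_filling_weight_initial_block:
  assumes "k < N" and "j \<le> Suc k"
  shows "(\<Sum>A | A \<subseteq> {l..<l + N} \<and> {l..<l + j} \<subseteq> A \<and> card A = k. filling_weight p A)
       = (\<Sum>s = j..k. real (k choose s) * (real (s + 1) ^ s / real (s + 1))
            * filling_sum p {Suc (l + s)..<Suc (l + s) + (N - s - 1)} (k - s))"
  unfolding filling_weight_interval[symmetric, where p = p and l = l]
proof (rule sum_filling_weight_by_first_gap[where x = "\<lambda>s. l + s"
      and I = "\<lambda>s. {l..<l + s}" and R = "\<lambda>s. {Suc (l + s)..<Suc (l + s) + (N - s - 1)}"])
  fix s assume "s \<le> k"
  then have "s < N"
    using assms(1) by simp
  then show "{l..<l + N} - {l + s} = {l..<l + s} \<union> {Suc (l + s)..<Suc (l + s) + (N - s - 1)}"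
    by auto
qed (use assms(2) in \<open>auto simp: separated_def\<close>)

lemma sum_filling_weight_final_block:
  assumes "k < N" and "j \<le> Suc k"
  shows "(\<Sum>A | A \<subseteq> {l..<l + N} \<and> {l + N - j..<l + N} \<subseteq> A \<and> card A = k. filling_weight p A)
       = (\<Sum>s = j..k. real (k choose s) * (real (s + 1) ^ s / real (s + 1))
            * filling_sum p {l..<l + (N - s - 1)} (k - s))"
proof -
  have "(\<Sum>A | A \<subseteq> {l..<l + N} \<and> {l + N - j..<l + N} \<subseteq> A \<and> card A = k. filling_weight p A)
      = (\<Sum>s = j..k. real (k choose s) * filling_weight p {l + N - s..<l + N}
            * filling_sum p {l..<l + (N - s - 1)} (k - s))"
  proof (rule sum_filling_weight_by_first_gap[where x = "\<lambda>s. l + N - Suc s"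
        and I = "\<lambda>s. {l + N - s..<l + N}" and R = "\<lambda>s. {l..<l + (N - s - 1)}"])
    fix s assume "s \<le> k"
    then have s: "s < N"
      using assms(1) by simp
    then show "{l..<l + N} - {l + N - Suc s} = {l + N - s..<l + N} \<union> {l..<l + (N - s - 1)}"
      by auto
    show "{l + N - Suc s..<l + N} = insert (l + N - Suc s) {l + N - s..<l + N}"
      using s by auto
    show "separated {l + N - s..<l + N} {l..<l + (N - s - 1)}"
      using s unfolding separated_def by auto
  next
    fix s assume "s \<le> Suc k"
    then show "card {l + N - s..<l + N} = s"
      using assms(1) by simp
  qed (use assms(2) in auto)
  also have "\<dots> = (\<Sum>s = j..k. real (k choose s) * (real (s + 1) ^ s / real (s + 1))
            * filling_sum p {l..<l + (N - s - 1)} (k - s))"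
  proof (rule sum.cong[OF refl])
    fix s assume "s \<in> {j..k}"
    then have "filling_weight p {l + N - s..<l + N} = real (s + 1) ^ s / real (s + 1)"
      using filling_weight_interval[of p "l + N - s" s] assms(1) by simp
    then show "real (k choose s) * filling_weight p {l + N - s..<l + N} * filling_sum p {l..<l + (N - s - 1)} (k - s)
        = real (k choose s) * (real (s + 1) ^ s / real (s + 1)) * filling_sum p {l..<l + (N - s - 1)} (k - s)"
      by (simp only:)
  qed
  finally show ?thesis .
qed

text \<open>
  By induction on \<open>N\<close>: the first gap reduces the sum to shorter intervals, and the symmetric Abel
  identity with \<open>x = 1\<close> and \<open>y = N - k\<close> evaluates the result. The decomposition presupposes that there
  is a gap, so \<open>k = N\<close> is separate. For \<open>0 < k\<close> the value is \<open>(N - k + 1) * (N + 1) ^ (k - 1)\<close>, a count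
  in which \<open>p\<close> does not occur.
\<close>

lemma filling_sum_interval:
  assumes "k \<le> N"
  shows "filling_sum p {l..<l + N} k = real (N - k + 1) * (real (N + 1) ^ k / real (N + 1))"
  using assms
proof (induction N arbitrary: l k rule: less_induct)
  case (less N)
  show ?case
  proof (cases "k = N")
    case True
    have "{A. A \<subseteq> {l..<l + N} \<and> card A = N} = {{l..<l + N}}"
      by (auto dest: card_subset_eq[rotated])
    then show ?thesis
      unfolding filling_sum_def True by (simp add: filling_weight_interval)
  next
    case False
    with less.prems have k: "k < N" by simp
    define y where "y = real (N - k)"
    have y: "y > 0" "1 + y + real k = real (N + 1)" "y + 1 = real (N - k + 1)"
      using k by (auto simp: y_def)
    have "filling_sum p {l..<l + N} k
        = (\<Sum>s = 0..k. real (k choose s) * (real (s + 1) ^ s / real (s + 1))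
            * filling_sum p {Suc (l + s)..<Suc (l + s) + (N - s - 1)} (k - s))"
      using sum_filling_weight_initial_block[OF k, of 0 p l] by (simp add: filling_sum_def)
    also have "\<dots> = (\<Sum>s\<le>k. y * (real (k choose s) * ((1 + real s) ^ s / (1 + real s))
        * ((y + real (k - s)) ^ (k - s) / (y + real (k - s)))))"
    proof (rule sum.cong)
      fix s assume "s \<in> {..k}"
      then have s: "s \<le> k" by simp
      have "filling_sum p {Suc (l + s)..<Suc (l + s) + (N - s - 1)} (k - s)
         = real (N - s - 1 - (k - s) + 1) * (real (N - s - 1 + 1) ^ (k - s) / real (N - s - 1 + 1))"
        using s k by (intro less.IH) auto
      also have "N - s - 1 - (k - s) + 1 = N - k"
        using s k by auto
      also have "real (N - s - 1 + 1) = y + real (k - s)"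
        using s k by (auto simp: y_def)
      finally show "real (k choose s) * (real (s + 1) ^ s / real (s + 1))
          * filling_sum p {Suc (l + s)..<Suc (l + s) + (N - s - 1)} (k - s)
        = y * (real (k choose s) * ((1 + real s) ^ s / (1 + real s))
          * ((y + real (k - s)) ^ (k - s) / (y + real (k - s))))"
        unfolding y_def by (simp only: mult_ac of_nat_add of_nat_1 add.commute)
    qed auto
    also have "\<dots> = y * ((1 / 1 + 1 / y) * (1 + y + real k) ^ k / (1 + y + real k))"
      using abel_binomial_symmetric[of 1 y k] y(1) by (simp only: sum_distrib_left[symmetric])
    also have "\<dots> = (y + 1) * ((1 + y + real k) ^ k / (1 + y + real k))"
    proof -
      have "y * (1 / 1 + 1 / y) = y + 1"
        using y(1) by (simp add: distrib_left)
      then show ?thesis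
        by (simp only: times_divide_eq_right[symmetric] mult.assoc[symmetric])
    qed
    finally show ?thesis
      unfolding y .
  qed
qed

text \<open>
  The sums of the theorem in quotient form, for \<open>k = m - 1\<close> earlier cars on \<open>N\<close> spots: the contribution
  of the filled sets with a full block of length at least \<open>j\<close> at one end of the street, divided by
  \<open>N - k\<close>.
\<close>

definition block_tail :: "nat \<Rightarrow> nat \<Rightarrow> nat \<Rightarrow> real" where
  "block_tail N k j = (\<Sum>s = j..k. real (k choose s) * (real (s + 1) ^ s / real (s + 1))
      * (real (N - s) ^ (k - s) / real (N - s)))"

lemma filling_sum_beside_block:
  assumes "s \<le> k" and "k < N"
  shows "filling_sum p {l..<l + (N - s - 1)} (k - s) = real (N - k) * (real (N - s) ^ (k - s) / real (N - s))"
proof -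
  have "N - s - 1 - (k - s) + 1 = N - k" "N - s - 1 + 1 = N - s"
    using assms by auto
  then show ?thesis
    using filling_sum_interval[of "k - s" "N - s - 1" p l] assms by simp
qed

lemma sum_filling_weight_initial_block_closed:
  assumes "k < n"
  shows "(\<Sum>A | A \<subseteq> {1..n} \<and> {1..j} \<subseteq> A \<and> card A = k. filling_weight p A) = real (n - k) * block_tail n k j"
proof (cases "j \<le> Suc k")
  case True
  have "(\<Sum>A | A \<subseteq> {1..<1 + n} \<and> {1..<1 + j} \<subseteq> A \<and> card A = k. filling_weight p A) = real (n - k) * block_tail n k j"
    unfolding sum_filling_weight_initial_block[OF assms True] block_tail_def sum_distrib_left
    by (rule sum.cong[OF refl]) (simp only: filling_sum_beside_block assms atLeastAtMost_iff mult.left_commute)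
  then show ?thesis
    by (simp add: atLeastLessThanSuc_atLeastAtMost)
next
  case False
  then show ?thesis
    using sum_small_supersets_eq_0[of "{1..n}" k "{1..j}" "filling_weight p"] by (simp add: block_tail_def)
qed

lemma sum_filling_weight_final_block_closed:
  assumes "k < n" and "j \<in> {1..n}"
  shows "(\<Sum>A | A \<subseteq> {1..n} \<and> {j..n} \<subseteq> A \<and> card A = k. filling_weight p A) = real (n - k) * block_tail n k (n - j + 1)"
proof (cases "n - j + 1 \<le> Suc k")
  case True
  have "(\<Sum>A | A \<subseteq> {1..<1 + n} \<and> {1 + n - (n - j + 1)..<1 + n} \<subseteq> A \<and> card A = k. filling_weight p A)
      = real (n - k) * block_tail n k (n - j + 1)"
    unfolding sum_filling_weight_final_block[OF assms(1) True] block_tail_def sum_distrib_left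
    by (rule sum.cong[OF refl]) (simp only: filling_sum_beside_block assms atLeastAtMost_iff mult.left_commute)
  moreover have "1 + n - (n - j + 1) = j"
    using assms(2) by simp
  ultimately show ?thesis
    by (simp add: atLeastLessThanSuc_atLeastAtMost)
next
  case False
  then show ?thesis
    using sum_small_supersets_eq_0[of "{1..n}" k "{j..n}" "filling_weight p"] assms by (simp add: block_tail_def)
qed

section \<open>Where a single car parks\<close>

lemma measure_bind_pmf:
  "measure (measure_pmf (bind_pmf M f)) X = measure_pmf.expectation M (\<lambda>x. measure (measure_pmf (f x)) X)"
  unfolding measure_pmf_bind
  by (rule measure_pmf.measure_bind[where N = "count_space UNIV"])
    (auto simp: space_subprob_algebra intro: prob_space_imp_subprob_space prob_space_measure_pmf)

text \<open>
  Failures are counted as \<open>0\<close>: the mean of \<open>h\<close> at the new set of occupied spots, restricted to the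
  event that the car parks.
\<close>

definition mean_after_car :: "real \<Rightarrow> nat \<Rightarrow> (nat set \<Rightarrow> real) \<Rightarrow> nat set \<Rightarrow> nat \<Rightarrow> real" where
  "mean_after_car p n h B a =
     measure_pmf.expectation (park_car p n B a) (\<lambda>r. case r of None \<Rightarrow> 0 | Some k \<Rightarrow> h (insert k B))"

primrec mean_if_parked :: "real \<Rightarrow> nat \<Rightarrow> (nat set \<Rightarrow> real) \<Rightarrow> nat set \<Rightarrow> nat list \<Rightarrow> real" where
  "mean_if_parked p n h B [] = h B"
| "mean_if_parked p n h B (a # as) = mean_after_car p n (\<lambda>B'. mean_if_parked p n h B' as) B a"

text \<open>
  The remaining cars enter only through a function of the spots occupied so far. This isolates the last
  car without a description of the joint law of an appended list.
\<close>

lemma mean_if_parked_append: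
  "mean_if_parked p n h B (as @ bs)
     = mean_if_parked p n (\<lambda>B'. mean_if_parked p n h B' bs) B as"
  by (induction as arbitrary: B) simp_all

lemma prob_all_parked:
  "measure (measure_pmf (park_cars p n B as)) {rs. all_parked rs} = mean_if_parked p n (\<lambda>_. 1) B as"
proof (induction as arbitrary: B)
  case Nil
  then show ?case by (simp add: all_parked_def)
next
  case (Cons a as)
  have "measure (measure_pmf (map_pmf (\<lambda>rs. r # rs) (park_cars p n (B \<union> set_option r) as))) {rs. all_parked rs}
      = (case r of None \<Rightarrow> 0 | Some k \<Rightarrow> mean_if_parked p n (\<lambda>_. 1) (insert k B) as)" for r
  proof (cases r)
    case None
    then show ?thesis by (simp add: all_parked_def)
  next
    case (Some k)
    then have "(\<lambda>rs. r # rs) -` {rs. all_parked rs} = {rs. all_parked rs}"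
      by (auto simp: all_parked_def)
    with Some show ?thesis by (simp add: Cons.IH)
  qed
  then show ?case
    unfolding park_cars.simps measure_bind_pmf mean_if_parked.simps mean_after_car_def
    by (simp only:)
qed

lemma mean_after_car_simps:
  assumes "0 \<le> p" and "p \<le> 1"
  shows "mean_after_car p n h B a = (if a \<notin> B then h (insert a B) else
      p * (case forward_spot n B a of None \<Rightarrow> 0 | Some k \<Rightarrow> h (insert k B))
      + (1 - p) * (case backward_spot n B a of None \<Rightarrow> 0 | Some k \<Rightarrow> h (insert k B)))"
  using assms by (simp add: mean_after_car_def park_car_def)

lemma forward_spot_eq_Some_iff:
  assumes "B \<subseteq> {1..n}" and "a \<in> B"
  shows "forward_spot n B a = Some k \<longleftrightarrow> k \<in> {1..n} - B \<and> a < k \<and> {a..<k} \<subseteq> B"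
proof -
  define S where "S = {k \<in> {1..n}. a < k \<and> k \<notin> B}"
  have "finite S"
    unfolding S_def by simp
  have "forward_spot n B a = Some k \<longleftrightarrow> S \<noteq> {} \<and> Min S = k"
    unfolding forward_spot_def S_def[symmetric] by (simp add: Let_def)
  also have "\<dots> \<longleftrightarrow> k \<in> S \<and> (\<forall>x\<in>S. k \<le> x)"
    using \<open>finite S\<close> by (metis Min_eq_iff empty_iff)
  also have "\<dots> \<longleftrightarrow> k \<in> {1..n} - B \<and> a < k \<and> {a..<k} \<subseteq> B"
  proof (intro iffI conjI)
    assume k: "k \<in> S \<and> (\<forall>x\<in>S. k \<le> x)"
    then show "k \<in> {1..n} - B" "a < k"
      unfolding S_def by auto
    show "{a..<k} \<subseteq> B"
    proof (rule subsetI, rule ccontr)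
      fix c assume c: "c \<in> {a..<k}" "c \<notin> B"
      then have "a < c"
        using assms(2) by (metis atLeastLessThan_iff le_neq_implies_less)
      with c k have "c \<in> S"
        unfolding S_def by auto
      with c k show False by auto
    qed
  next
    assume k: "k \<in> {1..n} - B \<and> a < k \<and> {a..<k} \<subseteq> B"
    then show "k \<in> S"
      unfolding S_def by auto
    show "\<forall>x\<in>S. k \<le> x"
    proof (rule ballI, rule ccontr)
      fix x assume x: "x \<in> S" "\<not> k \<le> x"
      then have "x \<in> {a..<k}"
        unfolding S_def by simp
      with k x(1) show False
        unfolding S_def by blast
    qed
  qed
  finally show ?thesis .
qed

lemma backward_spot_eq_Some_iff:
  assumes "B \<subseteq> {1..n}" and "a \<in> B"
  shows "backward_spot n B a = Some k \<longleftrightarrow> k \<in> {1..n} - B \<and> k < a \<and> {k<..a} \<subseteq> B"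
proof -
  define S where "S = {k \<in> {1..n}. k < a \<and> k \<notin> B}"
  have "finite S"
    unfolding S_def by simp
  have "backward_spot n B a = Some k \<longleftrightarrow> S \<noteq> {} \<and> Max S = k"
    unfolding backward_spot_def S_def[symmetric] by (simp add: Let_def)
  also have "\<dots> \<longleftrightarrow> k \<in> S \<and> (\<forall>x\<in>S. x \<le> k)"
    using \<open>finite S\<close> by (metis Max_eq_iff empty_iff)
  also have "\<dots> \<longleftrightarrow> k \<in> {1..n} - B \<and> k < a \<and> {k<..a} \<subseteq> B"
  proof (intro iffI conjI)
    assume k: "k \<in> S \<and> (\<forall>x\<in>S. x \<le> k)"
    then show "k \<in> {1..n} - B" "k < a"
      unfolding S_def by auto
    have "a \<in> {1..n}"
      using assms by blast
    show "{k<..a} \<subseteq> B"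
    proof (rule subsetI, rule ccontr)
      fix c assume c: "c \<in> {k<..a}" "c \<notin> B"
      then have "c < a"
        using assms(2) by (metis greaterThanAtMost_iff le_neq_implies_less)
      with c k \<open>a \<in> {1..n}\<close> have "c \<in> S"
        unfolding S_def by auto
      with c k show False by auto
    qed
  next
    assume k: "k \<in> {1..n} - B \<and> k < a \<and> {k<..a} \<subseteq> B"
    then show "k \<in> S"
      unfolding S_def by auto
    show "\<forall>x\<in>S. x \<le> k"
    proof (rule ballI, rule ccontr)
      fix x assume x: "x \<in> S" "\<not> x \<le> k"
      then have "x \<in> {k<..a}"
        unfolding S_def by simp
      with k x(1) show False
        unfolding S_def by blast
    qed
  qed
  finally show ?thesis .
qed

lemma sum_option_fibres:
  fixes H :: "nat \<Rightarrow> real"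
  assumes "finite B" and "finite K" and "\<And>a k. a \<in> B \<Longrightarrow> f a = Some k \<Longrightarrow> k \<in> K"
  shows "(\<Sum>a\<in>B. case f a of None \<Rightarrow> 0 | Some k \<Rightarrow> H k) = (\<Sum>k\<in>K. real (card {a \<in> B. f a = Some k}) * H k)"
proof -
  have "(\<Sum>a\<in>B. case f a of None \<Rightarrow> 0 | Some k \<Rightarrow> H k) = (\<Sum>a\<in>B. \<Sum>k\<in>K. if f a = Some k then H k else 0)"
  proof (rule sum.cong[OF refl])
    fix a assume "a \<in> B"
    with assms show "(case f a of None \<Rightarrow> 0 | Some k \<Rightarrow> H k) = (\<Sum>k\<in>K. if f a = Some k then H k else 0)"
      by (cases "f a") auto
  qed
  also have "\<dots> = (\<Sum>k\<in>K. \<Sum>a\<in>B. if f a = Some k then H k else 0)"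
    by (rule sum.swap)
  also have "\<dots> = (\<Sum>k\<in>K. real (card {a \<in> B. f a = Some k}) * H k)"
    using assms(1) by (simp add: sum.If_cases Int_def)
  finally show ?thesis .
qed

text \<open>
  Summed over all preferences, one car acts on functions of the occupied set by adding each free spot
  \<open>k\<close> with weight \<open>landing_weight p B k\<close>.
\<close>

lemma sum_mean_after_car:
  assumes "0 \<le> p" and "p \<le> 1" and B: "B \<subseteq> {1..n}"
  shows "(\<Sum>a = 1..n. mean_after_car p n h B a) = (\<Sum>k\<in>{1..n} - B. landing_weight p B k * h (insert k B))"
proof -
  let ?K = "{1..n} - B" and ?H = "\<lambda>k. h (insert k B)"
  have fin: "finite B"
    using B by (rule finite_subset) simp
  have fwd: "(\<Sum>a\<in>B. case forward_spot n B a of None \<Rightarrow> 0 | Some k \<Rightarrow> ?H k)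
      = (\<Sum>k\<in>?K. real (left_run B k) * ?H k)"
  proof -
    have "{a \<in> B. forward_spot n B a = Some k} = {a. a < k \<and> {a..<k} \<subseteq> B}" if "k \<in> ?K" for k
      using that forward_spot_eq_Some_iff[OF B] by (auto simp: subset_iff)
    then show ?thesis
      unfolding left_run_def using forward_spot_eq_Some_iff[OF B]
      by (subst sum_option_fibres[OF fin, of ?K]) auto
  qed
  have bwd: "(\<Sum>a\<in>B. case backward_spot n B a of None \<Rightarrow> 0 | Some k \<Rightarrow> ?H k)
      = (\<Sum>k\<in>?K. real (right_run B k) * ?H k)"
  proof -
    have "{a \<in> B. backward_spot n B a = Some k} = {a. k < a \<and> {k<..a} \<subseteq> B}" if "k \<in> ?K" for k
      using that backward_spot_eq_Some_iff[OF B] by (auto simp: subset_iff)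
    then show ?thesis
      unfolding right_run_def using backward_spot_eq_Some_iff[OF B]
      by (subst sum_option_fibres[OF fin, of ?K]) auto
  qed
  have "(\<Sum>a = 1..n. mean_after_car p n h B a)
      = (\<Sum>a\<in>?K. mean_after_car p n h B a) + (\<Sum>a\<in>B. mean_after_car p n h B a)"
    using B by (intro sum.subset_diff) simp_all
  also have "(\<Sum>a\<in>?K. mean_after_car p n h B a) = (\<Sum>k\<in>?K. ?H k)"
    using assms(1,2) by (intro sum.cong) (simp_all add: mean_after_car_simps)
  also have "(\<Sum>a\<in>B. mean_after_car p n h B a)
      = p * (\<Sum>k\<in>?K. real (left_run B k) * ?H k) + (1 - p) * (\<Sum>k\<in>?K. real (right_run B k) * ?H k)"
    unfolding fwd[symmetric] bwd[symmetric]
    using assms(1,2) by (simp add: mean_after_car_simps sum.distrib sum_distrib_left)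
  also have "(\<Sum>k\<in>?K. ?H k) + \<dots> = (\<Sum>k\<in>?K. landing_weight p B k * ?H k)"
    unfolding landing_weight_def sum_distrib_left sum.distrib[symmetric]
    by (intro sum.cong refl) (simp only: distrib_right mult_1_left mult.assoc add.assoc)
  finally show ?thesis .
qed

lemma forward_spot_eq_None_iff:
  assumes "a \<in> B" and "1 \<le> a"
  shows "forward_spot n B a = None \<longleftrightarrow> {a..n} \<subseteq> B"
proof -
  have "forward_spot n B a = None \<longleftrightarrow> (\<forall>k. k \<le> n \<and> a < k \<longrightarrow> k \<in> B)"
    using assms(2) by (auto simp: forward_spot_def Let_def)
  also have "\<dots> \<longleftrightarrow> {a..n} \<subseteq> B"
    using assms(1) by (auto simp: subset_iff le_less)
  finally show ?thesis .
qed

lemma backward_spot_eq_None_iff: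
  assumes "a \<in> B" and "a \<le> n"
  shows "backward_spot n B a = None \<longleftrightarrow> {1..a} \<subseteq> B"
proof -
  have "backward_spot n B a = None \<longleftrightarrow> (\<forall>k. 1 \<le> k \<and> k < a \<longrightarrow> k \<in> B)"
    using assms(2) by (auto simp: backward_spot_def Let_def)
  also have "\<dots> \<longleftrightarrow> {1..a} \<subseteq> B"
    using assms(1) by (auto simp: subset_iff le_less)
  finally show ?thesis .
qed

text \<open>
  The car fails exactly if it is sent towards an end of the street and finds no free spot there.
\<close>

lemma mean_after_car_one:
  assumes "0 \<le> p" and "p \<le> 1" and "j \<in> {1..n}"
  shows "mean_after_car p n (\<lambda>_. 1) A j = 1 - p * of_bool ({j..n} \<subseteq> A) - (1 - p) * of_bool ({1..j} \<subseteq> A)"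
proof (cases "j \<in> A")
  case False
  then have "\<not> {j..n} \<subseteq> A" "\<not> {1..j} \<subseteq> A"
    using assms(3) by auto
  with False show ?thesis
    by (simp add: mean_after_car_simps[OF assms(1,2)])
next
  case True
  have "(case forward_spot n A j of None \<Rightarrow> 0 | Some k \<Rightarrow> 1) = 1 - (of_bool ({j..n} \<subseteq> A) :: real)"
    using forward_spot_eq_None_iff[OF True, of n] assms(3) by (auto split: option.split)
  moreover have "(case backward_spot n A j of None \<Rightarrow> 0 | Some k \<Rightarrow> 1) = 1 - (of_bool ({1..j} \<subseteq> A) :: real)"
    using backward_spot_eq_None_iff[OF True, of n] assms(3) by (auto split: option.split)
  moreover have "mean_after_car p n (\<lambda>_. 1) A j
      = p * (case forward_spot n A j of None \<Rightarrow> 0 | Some k \<Rightarrow> 1)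
        + (1 - p) * (case backward_spot n A j of None \<Rightarrow> 0 | Some k \<Rightarrow> 1)"
    using True by (simp add: mean_after_car_simps[OF assms(1,2)])
  ultimately show ?thesis
    by (simp only: right_diff_distrib mult_1_right)
qed

section \<open>From preference lists to weights\<close>

text \<open>
  The forward description of a car, which adds a spot to a given set, is dual to the recursion for the
  weight, which removes a spot from the resulting set. Both sides run over the pairs of a set and its
  last spot.
\<close>

lemma sum_filling_weight_add_car:
  assumes "finite X"
  shows "(\<Sum>A | A \<subseteq> X \<and> card A = k. filling_weight p A * (\<Sum>x\<in>X - A. landing_weight p A x * H (insert x A)))
       = (\<Sum>A | A \<subseteq> X \<and> card A = Suc k. filling_weight p A * H A)"
proof -
  let ?w = "filling_weight p" and ?g = "landing_weight p"
  have fin: "finite A" if "A \<subseteq> X" for A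
    using that assms by (rule finite_subset)
  have fin': "finite {A. A \<subseteq> X \<and> card A = i}" for i
    using assms by (auto intro: rev_finite_subset[of "Pow X"])
  have "(\<Sum>A | A \<subseteq> X \<and> card A = k. ?w A * (\<Sum>x\<in>X - A. ?g A x * H (insert x A)))
      = (\<Sum>(A, x)\<in>(SIGMA A:{A. A \<subseteq> X \<and> card A = k}. X - A). ?w A * (?g A x * H (insert x A)))"
    using assms fin' by (simp add: sum_distrib_left sum.Sigma)
  also have "\<dots> = (\<Sum>(A, x)\<in>(SIGMA A:{A. A \<subseteq> X \<and> card A = Suc k}. A). ?w (A - {x}) * ?g (A - {x}) x * H A)"
    by (rule sum.reindex_bij_witness[of _ "\<lambda>(A, x). (A - {x}, x)" "\<lambda>(A, x). (insert x A, x)"])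
      (auto simp: insert_absorb fin)
  also have "\<dots> = (\<Sum>A | A \<subseteq> X \<and> card A = Suc k. (\<Sum>x\<in>A. ?w (A - {x}) * ?g (A - {x}) x) * H A)"
    using fin' fin by (simp add: sum_distrib_right sum.Sigma)
  also have "\<dots> = (\<Sum>A | A \<subseteq> X \<and> card A = Suc k. ?w A * H A)"
  proof (rule sum.cong[OF refl])
    fix A assume "A \<in> {A. A \<subseteq> X \<and> card A = Suc k}"
    then have "finite A" "A \<noteq> {}"
      using fin by auto
    then show "(\<Sum>x\<in>A. ?w (A - {x}) * ?g (A - {x}) x) * H A = ?w A * H A"
      using filling_weight_last_car[of A p] by simp
  qed
  finally show ?thesis .
qed

lemma finite_preference_lists: "finite (preference_lists m n)"
  unfolding preference_lists_def
  using finite_lists_length_eq[of "{1..n}" m] by (simp add: conj_commute)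

lemma card_preference_lists: "card (preference_lists m n) = n ^ m"
  unfolding preference_lists_def
  using card_lists_length_eq[of "{1..n}" m] by (simp add: conj_commute)

lemma sum_preference_lists_Suc:
  "(\<Sum>\<alpha>\<in>preference_lists (Suc m) n. F \<alpha>) = (\<Sum>as\<in>preference_lists m n. \<Sum>a = 1..n. F (a # as))"
proof -
  have "(\<Sum>as\<in>preference_lists m n. \<Sum>a = 1..n. F (a # as))
      = (\<Sum>(as, a)\<in>preference_lists m n \<times> {1..n}. F (a # as))"
    by (rule sum.cartesian_product)
  also have "\<dots> = (\<Sum>\<alpha>\<in>preference_lists (Suc m) n. F \<alpha>)"
    by (rule sum.reindex_bij_witness[of _ "\<lambda>\<alpha>. (tl \<alpha>, hd \<alpha>)" "\<lambda>(as, a). a # as"])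
      (auto simp: preference_lists_def length_Suc_conv)
  finally show ?thesis ..
qed

lemma sum_preference_lists_snoc:
  "(\<Sum>\<alpha>\<in>{\<alpha> \<in> preference_lists (Suc m) n. \<alpha> ! m = j}. F \<alpha>) = (\<Sum>as\<in>preference_lists m n. F (as @ [j]))"
  if "j \<in> {1..n}"
proof (rule sum.reindex_bij_witness[of _ "\<lambda>as. as @ [j]" butlast])
  fix \<alpha> assume \<alpha>: "\<alpha> \<in> {\<alpha> \<in> preference_lists (Suc m) n. \<alpha> ! m = j}"
  then obtain as a where "\<alpha> = as @ [a]"
    by (cases \<alpha> rule: rev_cases) (auto simp: preference_lists_def)
  with \<alpha> show "butlast \<alpha> @ [j] = \<alpha>" "butlast \<alpha> \<in> preference_lists m n" "F (butlast \<alpha> @ [j]) = F \<alpha>"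
    by (auto simp: preference_lists_def)
qed (use that in \<open>auto simp: preference_lists_def\<close>)

text \<open>
  Cars are consumed from the front of the list, while the weight recursion removes cars from the end.
  Starting from the weights of all sets with \<open>k\<close> elements reconciles the two: each car passes the
  weights on to the sets with one more element.
\<close>

lemma sum_mean_if_parked_from:
  assumes "0 \<le> p" and "p \<le> 1"
  shows "(\<Sum>A | A \<subseteq> {1..n} \<and> card A = k.
            filling_weight p A * (\<Sum>\<alpha>\<in>preference_lists m n. mean_if_parked p n h A \<alpha>))
       = (\<Sum>A | A \<subseteq> {1..n} \<and> card A = k + m. filling_weight p A * h A)"
proof (induction m arbitrary: k)
  case 0
  have "preference_lists 0 n = {[]}"
    by (auto simp: preference_lists_def)
  then show ?case by simp
next
  case (Suc m)
  let ?H = "\<lambda>A. \<Sum>\<alpha>\<in>preference_lists m n. mean_if_parked p n h A \<alpha>"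
  have "(\<Sum>\<alpha>\<in>preference_lists (Suc m) n. mean_if_parked p n h A \<alpha>)
      = (\<Sum>x\<in>{1..n} - A. landing_weight p A x * ?H (insert x A))" if "A \<subseteq> {1..n}" for A
  proof -
    have "(\<Sum>\<alpha>\<in>preference_lists (Suc m) n. mean_if_parked p n h A \<alpha>)
        = (\<Sum>\<alpha>\<in>preference_lists m n. \<Sum>x\<in>{1..n} - A. landing_weight p A x * mean_if_parked p n h (insert x A) \<alpha>)"
      unfolding sum_preference_lists_Suc mean_if_parked.simps sum_mean_after_car[OF assms that] ..
    also have "\<dots> = (\<Sum>x\<in>{1..n} - A. landing_weight p A x * ?H (insert x A))"
      by (subst sum.swap) (simp only: sum_distrib_left)
    finally show ?thesis .
  qed
  then have "(\<Sum>A | A \<subseteq> {1..n} \<and> card A = k.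
        filling_weight p A * (\<Sum>\<alpha>\<in>preference_lists (Suc m) n. mean_if_parked p n h A \<alpha>))
      = (\<Sum>A | A \<subseteq> {1..n} \<and> card A = k.
        filling_weight p A * (\<Sum>x\<in>{1..n} - A. landing_weight p A x * ?H (insert x A)))"
    by (intro sum.cong) auto
  also have "\<dots> = (\<Sum>A | A \<subseteq> {1..n} \<and> card A = Suc k. filling_weight p A * ?H A)"
    by (rule sum_filling_weight_add_car) simp
  also have "\<dots> = (\<Sum>A | A \<subseteq> {1..n} \<and> card A = k + Suc m. filling_weight p A * h A)"
    using Suc.IH[of "Suc k"] by simp
  finally show ?case .
qed

lemma sum_mean_if_parked:
  assumes "0 \<le> p" and "p \<le> 1"
  shows "(\<Sum>\<alpha>\<in>preference_lists m n. mean_if_parked p n h {} \<alpha>)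
       = (\<Sum>A | A \<subseteq> {1..n} \<and> card A = m. filling_weight p A * h A)"
proof -
  have "{A. A \<subseteq> {1..n} \<and> card A = 0} = {{}}"
    by (auto dest: finite_subset)
  then show ?thesis
    using sum_mean_if_parked_from[OF assms, where k = 0 and m = m and n = n and h = h] by simp
qed

section \<open>The law of the last preference\<close>

lemma measure_parking_experiment:
  assumes "1 \<le> n"
  shows "measure (measure_pmf (parking_experiment p m n)) S
       = (\<Sum>\<alpha>\<in>preference_lists m n. measure (measure_pmf (park_cars p n {} \<alpha>)) {rs. (\<alpha>, rs) \<in> S}) / real n ^ m"
proof -
  have "preference_lists m n \<noteq> {}"
    using card_preference_lists[of m n] assms by auto
  then show ?thesis
    unfolding parking_experiment_def measure_bind_pmf
    by (simp add: integral_pmf_of_set finite_preference_lists card_preference_lists vimage_def)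
qed

lemma prob_all_parked_total:
  assumes "0 \<le> p" and "p \<le> 1" and "1 \<le> m" and "m \<le> n"
  shows "measure (measure_pmf (parking_experiment p m n)) {(\<alpha>, rs). all_parked rs}
       = real (n - m + 1) * real (n + 1) ^ (m - 1) / real n ^ m"
proof -
  have "(\<Sum>\<alpha>\<in>preference_lists m n. mean_if_parked p n (\<lambda>_. 1) {} \<alpha>) = filling_sum p {1..<1 + n} m"
    unfolding sum_mean_if_parked[OF assms(1,2)] filling_sum_def
    by (simp add: atLeastLessThanSuc_atLeastAtMost)
  also have "\<dots> = real (n - m + 1) * (real (n + 1) ^ m / real (n + 1))"
    using assms(4) by (rule filling_sum_interval)
  also have "real (n + 1) ^ m / real (n + 1) = real (n + 1) ^ (m - 1)"
    using assms(3) by (cases m) auto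
  finally show ?thesis
    using assms(3,4) by (simp add: measure_parking_experiment prob_all_parked)
qed

text \<open>
  The first \<open>k\<close> cars fill a set \<open>A\<close> with weight \<open>w A\<close>; the last car contributes \<open>1\<close> minus its failure
  probability, and the failures are sums over sets that contain a block at an end of the street.
\<close>

lemma prob_all_parked_last_preference:
  assumes "0 \<le> p" and "p \<le> 1" and "k < n" and "j \<in> {1..n}"
  shows "measure (measure_pmf (parking_experiment p (Suc k) n)) {(\<alpha>, rs). \<alpha> ! k = j \<and> all_parked rs}
       = (real (n - k + 1) * real (n + 1) ^ k / real (n + 1)
          - real (n - k) * (p * block_tail n k (n - j + 1) + (1 - p) * block_tail n k j)) / real n ^ Suc k"
proof -
  let ?E = "mean_if_parked p n (\<lambda>_. 1)"
  let ?X = "{A. A \<subseteq> {1..n} \<and> card A = k}"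
  have fin: "finite ?X"
    by (rule finite_subset[of _ "Pow {1..n}"]) auto
  have restrict: "(\<Sum>A\<in>?X. filling_weight p A * of_bool (I \<subseteq> A))
      = (\<Sum>A | A \<subseteq> {1..n} \<and> I \<subseteq> A \<and> card A = k. filling_weight p A)" for I
    using fin by (intro sum.mono_neutral_cong_right) auto
  have "(\<Sum>\<alpha>\<in>preference_lists (Suc k) n.
          measure (measure_pmf (park_cars p n {} \<alpha>)) {rs. \<alpha> ! k = j \<and> all_parked rs})
      = (\<Sum>\<alpha>\<in>{\<alpha> \<in> preference_lists (Suc k) n. \<alpha> ! k = j}. ?E {} \<alpha>)"
    by (intro sum.mono_neutral_cong_right) (auto simp: finite_preference_lists prob_all_parked)
  also have "\<dots> = (\<Sum>\<alpha>\<in>preference_lists k n. ?E {} (\<alpha> @ [j]))"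
    by (rule sum_preference_lists_snoc[OF assms(4)])
  also have "\<dots> = (\<Sum>A\<in>?X. filling_weight p A * mean_after_car p n (\<lambda>_. 1) A j)"
    unfolding mean_if_parked_append sum_mean_if_parked[OF assms(1,2)] by simp
  also have "\<dots> = (\<Sum>A\<in>?X. filling_weight p A)
      - p * (\<Sum>A\<in>?X. filling_weight p A * of_bool ({j..n} \<subseteq> A))
      - (1 - p) * (\<Sum>A\<in>?X. filling_weight p A * of_bool ({1..j} \<subseteq> A))"
    unfolding mean_after_car_one[OF assms(1,2,4)] sum_distrib_left sum_subtractf[symmetric]
    by (intro sum.cong refl) (simp only: right_diff_distrib mult.left_commute mult_1_right)
  also have "(\<Sum>A\<in>?X. filling_weight p A) = real (n - k + 1) * (real (n + 1) ^ k / real (n + 1))"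
    using filling_sum_interval[of k n p 1] assms(3)
    by (simp add: filling_sum_def atLeastLessThanSuc_atLeastAtMost)
  also have "(\<Sum>A\<in>?X. filling_weight p A * of_bool ({j..n} \<subseteq> A)) = real (n - k) * block_tail n k (n - j + 1)"
    unfolding restrict by (rule sum_filling_weight_final_block_closed[OF assms(3,4)])
  also have "(\<Sum>A\<in>?X. filling_weight p A * of_bool ({1..j} \<subseteq> A)) = real (n - k) * block_tail n k j"
    unfolding restrict by (rule sum_filling_weight_initial_block_closed[OF assms(3)])
  finally show ?thesis
    using assms(3) by (simp add: measure_parking_experiment algebra_simps)
qed

lemma block_tail_eq_powi:
  assumes "k < n"
  shows "block_tail n k j = (\<Sum>s = j..k. real (k choose s)
      * (real n - real s) powi (int (Suc k) - int s - 2) * (real s + 1) ^ (s - 1))"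
  unfolding block_tail_def
proof (rule sum.cong[OF refl])
  fix s assume "s \<in> {j..k}"
  then have s: "s \<le> k" by simp
  have nz: "real (n - s) \<noteq> 0" and e: "real n - real s = real (n - s)" "int (Suc k) - int s - 2 = int (k - s) - 1"
    using s assms by (simp_all add: of_nat_diff)
  have pow: "(real n - real s) powi (int (Suc k) - int s - 2) = real (n - s) ^ (k - s) / real (n - s)"
    unfolding e using power_int_diff[of "real (n - s)" "int (k - s)" 1] nz by simp
  have block: "real (s + 1) ^ s / real (s + 1) = (real s + 1) ^ (s - 1)"
    by (cases s) (simp_all add: add_ac)
  show "real (k choose s) * (real (s + 1) ^ s / real (s + 1)) * (real (n - s) ^ (k - s) / real (n - s))
      = real (k choose s) * (real n - real s) powi (int (Suc k) - int s - 2) * (real s + 1) ^ (s - 1)"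
    unfolding pow block by (simp only: mult_ac)
qed

lemma quotient_cancel:
  fixes D M Q T c :: real
  assumes "D > 0" and "M > 0" and "Q > 0" and "c > 0"
  shows "(((D + 1) * Q / M - D * T) / c) / (D * Q / c) = (D + 1) / (D * M) - 1 / Q * T"
proof -
  have "(((D + 1) * Q / M - D * T) / c) / (D * Q / c) = ((D + 1) * Q / M - D * T) / (D * Q)"
    using assms(4) by simp
  also have "\<dots> = ((D + 1) * Q / M) / (D * Q) - (D * T) / (D * Q)"
    by (rule diff_divide_distrib)
  also have "(D * T) / (D * Q) = 1 / Q * T"
    using assms(1) by simp
  also have "((D + 1) * Q / M) / (D * Q) = (D + 1) / (D * M)"
    using assms(3) by simp
  finally show ?thesis .
qed

theorem theorem2p7:
  fixes m n j :: nat and p :: real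
  assumes "1 \<le> m" and "m \<le> n" and "0 \<le> p" and "p \<le> 1" and "j \<in> {1..n}"
  shows "\<P>((\<alpha>, rs) in measure_pmf (parking_experiment p m n). \<alpha> ! (m - 1) = j \<bar> all_parked rs) =
      (real n - real m + 2) / ((real n - real m + 1) * (real n + 1))
      - 1 / (real n + 1) ^ (m - 1) *
        (p * (\<Sum>s = n - j + 1..m - 1. real ((m - 1) choose s)
                * (real n - real s) powi (int m - int s - 2) * (real s + 1) ^ (s - 1))
         + (1 - p) * (\<Sum>s = j..m - 1. real ((m - 1) choose s)
                * (real n - real s) powi (int m - int s - 2) * (real s + 1) ^ (s - 1)))"
proof -
  obtain k where m: "m = Suc k"
    using assms(1) by (cases m) auto
  with assms(2) have k: "k < n" by simp
  let ?T = "p * block_tail n k (n - j + 1) + (1 - p) * block_tail n k j"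
  define D where "D = real (n - k)"
  define M where "M = real (n + 1)"
  have pos: "D > 0" "M > 0" "real n ^ Suc k > 0"
    using k by (simp_all add: D_def M_def)
  have "\<P>((\<alpha>, rs) in measure_pmf (parking_experiment p m n). \<alpha> ! (m - 1) = j \<bar> all_parked rs)
      = measure (measure_pmf (parking_experiment p (Suc k) n)) {(\<alpha>, rs). \<alpha> ! k = j \<and> all_parked rs}
        / measure (measure_pmf (parking_experiment p (Suc k) n)) {(\<alpha>, rs). all_parked rs}"
    unfolding cond_prob_def m by (simp add: case_prod_beta')
  also have "\<dots> = (((D + 1) * M ^ k / M - D * ?T) / real n ^ Suc k) / (D * M ^ k / real n ^ Suc k)"
  proof -
    have e: "real (n - k + 1) = real (n - k) + 1" "real (n - Suc k + 1) = real (n - k)"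
      using k by (simp_all add: Suc_diff_Suc)
    show ?thesis
      unfolding prob_all_parked_last_preference[OF assms(3,4) k assms(5)]
        prob_all_parked_total[OF assms(3,4) assms(1,2), unfolded m] e D_def M_def diff_Suc_1 ..
  qed
  also have "\<dots> = (D + 1) / (D * M) - 1 / M ^ k * ?T"
    using pos by (intro quotient_cancel) simp_all
  finally have main: "\<P>((\<alpha>, rs) in measure_pmf (parking_experiment p m n). \<alpha> ! (m - 1) = j \<bar> all_parked rs)
      = (D + 1) / (D * M) - 1 / M ^ k * ?T" .
  have "real n - real (Suc k) + 2 = D + 1" "real n - real (Suc k) + 1 = D" "real n + 1 = M"
    using k by (simp_all add: D_def M_def of_nat_diff)
  then show ?thesis
    using main unfolding m diff_Suc_1 block_tail_eq_powi[OF k] by (simp only:)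
qed

end
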